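(* Let $X$ be a finite set and let $\mathcal{G}$ be a convex geometry on $X$ with $cdim=2$, generated by two chains $C_1$ and $C_2$, and assume that the lattice $\mathcal{G}$ has at least two atoms and at least two coatoms. In what follows $\{i,i'\}=\{1,2\}$. The complements $\mathcal{G}\setminus\mathcal{M}$ of maximal sublattices $\mathcal{M}$ of $\mathcal{G}$ are precisely the sets of one of the following three forms: (1) intervals $[(j),C_i(j)]$, where $j\in X$, $i\in\{1,2\}$, and there is $x\in X$ such that $C_i(j)\prec C_i(x)$ and $C_{i'}(j)>C_{i'}(x)$ (in this case $(j)$ is not an element of the chain $C_{i'}$); (2) intervals $[(j),C_i(j)]$, where $j\in X$, $i\in\{1,2\}$, $(j)$ is an element of the chain $C_{i'}$, and there is $x\in X$ such that both $C_1(j)\prec C_1(x)$ and $C_2(j)\prec C_2(x)$; (3) unions of intervals $[(j),C_1(j)]\cup[(j),C_2(j)]$, where $j\in X$, $(j)$ is an element of neither $C_1$ nor $C_2$, and there is $x\in X$ such that both $C_1(j)\prec C_1(x)$ and $C_2(j)\prec C_2(x)$.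
   Context: Convex geometry generated by chains: let $X$ be a finite set with $m$ elements and let $<_1,\dots,<_n$ be linear orders on $X$. For each $i$, let $C_i$ be the chain of all initial segments (down-sets) of $(X,<_i)$, from $\emptyset$ to $X$. The set $\mathcal{G}$ of all intersections of members of the chains $C_1,\dots,C_n$, ordered by inclusion, is a lattice (with meet equal to intersection), called the convex geometry generated by $C_1,\dots,C_n$; its $cdim$ is the minimum number of chains needed to generate it in this way. For $y\in X$, $C_i(y)=\{z\in X: z\le_i y\}$ is the least member of the chain $C_i$ containing $y$, and $(y)$ is the least member of $\mathcal{G}$ containing $y$. The order $\le$ on $\mathcal{G}$ is inclusion; $a\prec b$ means that $b$ covers $a$ in $\mathcal{G}$ (i.e. $a<b$ and no $c \in \mathcal{G}$ satisfies $a<c<b$); intervals $[a,b]=\{c\in\mathcal{G}: a\le c\le b\}$ are taken in $\mathcal{G}$. A maximal sublattice of a lattice is a proper (nonempty) sublattice not contained in any other proper sublattice. Atoms are the covers of the least element, coatoms are the subcovers of the greatest element. *)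

theory Defs
  imports "HOL-Algebra.Lattice"
begin

section \<open>Covers and maximal sublattices of a lattice\<close>

definition covered_by :: "[_, 'a, 'a] \<Rightarrow> bool" (infixl \<open>\<prec>\<index>\<close> 50)
  where "a \<prec>\<^bsub>L\<^esub> b \<longleftrightarrow> a \<in> carrier L \<and> b \<in> carrier L \<and> a \<sqsubset>\<^bsub>L\<^esub> b \<and>
    \<not> (\<exists>c\<in>carrier L. a \<sqsubset>\<^bsub>L\<^esub> c \<and> c \<sqsubset>\<^bsub>L\<^esub> b)"

definition atoms :: "('a, 'b) gorder_scheme \<Rightarrow> 'a set"
  where "atoms L = {a. \<bottom>\<^bsub>L\<^esub> \<prec>\<^bsub>L\<^esub> a}"

definition coatoms :: "('a, 'b) gorder_scheme \<Rightarrow> 'a set"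
  where "coatoms L = {a. a \<prec>\<^bsub>L\<^esub> \<top>\<^bsub>L\<^esub>}"

text \<open>A sublattice need not contain the least or the greatest element of the lattice.\<close>

definition sublattice :: "'a set \<Rightarrow> ('a, 'b) gorder_scheme \<Rightarrow> bool"
  where "sublattice S L \<longleftrightarrow> S \<noteq> {} \<and> S \<subseteq> carrier L \<and>
    (\<forall>a\<in>S. \<forall>b\<in>S. a \<sqinter>\<^bsub>L\<^esub> b \<in> S \<and> a \<squnion>\<^bsub>L\<^esub> b \<in> S)"

definition maximal_sublattice :: "'a set \<Rightarrow> ('a, 'b) gorder_scheme \<Rightarrow> bool"
  where "maximal_sublattice M L \<longleftrightarrow> sublattice M L \<and> M \<noteq> carrier L \<and>
    \<not> (\<exists>S. sublattice S L \<and> S \<noteq> carrier L \<and> M \<subset> S)"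


section \<open>Convex geometries generated by chains\<close>

text \<open>Linear orders on \<^term>\<open>X\<close> are reflexive relations in the sense of
  \<^const>\<open>linear_order_on\<close>: \<^term>\<open>(z, y) \<in> r\<close> reads ``\<open>z \<le> y\<close>''.\<close>

definition segment_chain :: "'a set \<Rightarrow> ('a \<times> 'a) set \<Rightarrow> 'a set set"
  where "segment_chain X r = {D. D \<subseteq> X \<and> (\<forall>y\<in>D. \<forall>z\<in>X. (z, y) \<in> r \<longrightarrow> z \<in> D)}"

definition principal_segment :: "'a set \<Rightarrow> ('a \<times> 'a) set \<Rightarrow> 'a \<Rightarrow> 'a set"
  where "principal_segment X r y = {z \<in> X. (z, y) \<in> r}"

text \<open>Only nonempty families are intersected, as \<^term>\<open>\<Inter>{}\<close> is \<^term>\<open>UNIV\<close>; the empty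
  intersection relative to \<^term>\<open>X\<close> is \<^term>\<open>X\<close>, which belongs to every chain.
  The orders are \<open>r 1, \<dots>, r n\<close>; the values of \<^term>\<open>r\<close> at other indices play no role.\<close>

definition chain_geometry :: "'a set \<Rightarrow> nat \<Rightarrow> (nat \<Rightarrow> ('a \<times> 'a) set) \<Rightarrow> 'a set gorder"
  where "chain_geometry X n r =
    \<lparr>carrier = {\<Inter>F |F. F \<noteq> {} \<and> F \<subseteq> (\<Union>i\<in>{1..n}. segment_chain X (r i))},
     eq = (=), le = (\<subseteq>)\<rparr>"

definition cdim :: "'a set \<Rightarrow> 'a set gorder \<Rightarrow> nat"
  where "cdim X G = (LEAST n. \<exists>r. (\<forall>i\<in>{1..n}. linear_order_on X (r i)) \<and> G = chain_geometry X n r)"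

definition point_closure :: "'a set gorder \<Rightarrow> 'a \<Rightarrow> 'a set"
  where "point_closure G y = (LEAST A. A \<in> carrier G \<and> y \<in> A)"

end

theory Submission
  imports Defs
begin

text \<open>A closed set is one that contains every point lying, in each order, below some member.
  For a closed \<open>A\<close> with greatest element \<open>j\<close> in the order \<open>i\<close> we have \<open>(j) \<subseteq> A \<subseteq> C\<^sub>i(j)\<close>, and
  conversely; so the interval \<open>[(j), C\<^sub>i(j)]\<close> is a fibre of the map ``\<open>i\<close>-greatest element'', under
  which joins become maxima. Hence removing such fibres always leaves a set closed under joins, and
  the conditions on the \<open>i\<close>-successor \<open>x\<close> of \<open>j\<close> make every remaining set that contains \<open>j\<close> contain
  \<open>x\<close>, which gives closure under meets. Maximality holds since any \<open>A\<close> in a removed fibre meets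
  \<open>C\<^sub>i\<^sub>'(j)\<close> or \<open>C\<^sub>i\<^sub>'(x)\<close> in \<open>(j)\<close>, and every \<open>B\<close> in it equals \<open>(j) \<squnion> (B - {j})\<close>.
  Conversely, a sublattice meeting every set of the list meets all fibres, by downward induction
  along each order; a member with \<open>1\<close>-greatest element \<open>j\<close> and one with \<open>2\<close>-greatest element \<open>j\<close> meet
  in \<open>(j)\<close>, and the sets \<open>(j)\<close> generate the lattice.\<close>

section \<open>Finite linear orders\<close>

lemma linear_order_on_mem:
  assumes "linear_order_on X r" and "(x, y) \<in> r"
  shows "x \<in> X" "y \<in> X"
  using assms by (auto simp: order_on_defs)

lemma linear_order_on_refl: "linear_order_on X r \<Longrightarrow> x \<in> X \<Longrightarrow> (x, x) \<in> r"
  by (auto simp: order_on_defs refl_on_def)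

lemma linear_order_on_trans: "linear_order_on X r \<Longrightarrow> (x, y) \<in> r \<Longrightarrow> (y, z) \<in> r \<Longrightarrow> (x, z) \<in> r"
  by (auto simp: order_on_defs dest: transD)

lemma linear_order_on_antisym: "linear_order_on X r \<Longrightarrow> (x, y) \<in> r \<Longrightarrow> (y, x) \<in> r \<Longrightarrow> x = y"
  by (auto simp: order_on_defs dest: antisymD)

lemma linear_order_on_total:
  "linear_order_on X r \<Longrightarrow> x \<in> X \<Longrightarrow> y \<in> X \<Longrightarrow> (x, y) \<in> r \<or> (y, x) \<in> r"
  by (cases "x = y") (auto simp: order_on_defs refl_on_def total_on_def)

lemma linear_order_on_greatest:
  assumes lin: "linear_order_on X r" and "finite B" "B \<noteq> {}" "B \<subseteq> X"
  obtains m where "m \<in> B" "\<And>z. z \<in> B \<Longrightarrow> (z, m) \<in> r"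
proof -
  have "\<exists>m\<in>B. \<forall>z\<in>B. (z, m) \<in> r"
    using assms(2-4)
  proof (induction B rule: finite_ne_induct)
    case (singleton b)
    then show ?case
      using linear_order_on_refl[OF lin] by auto
  next
    case (insert b B)
    then obtain m where m: "m \<in> B" "\<forall>z\<in>B. (z, m) \<in> r"
      by auto
    then have "(b, m) \<in> r \<or> (m, b) \<in> r"
      using insert.prems linear_order_on_total[OF lin, of b m] by auto
    then show ?case
      using m insert.prems linear_order_on_refl[OF lin, of b] linear_order_on_trans[OF lin, of _ m b]
      by auto
  qed
  then show ?thesis
    using that by blast
qed

text \<open>The immediate successor, stated inside the order alone;
  \<open>covered_by_iff_next_in\<close> identifies it with a cover between principal segments in the
  lattice.\<close>

definition next_in :: "('a \<times> 'a) set \<Rightarrow> 'a set \<Rightarrow> 'a \<Rightarrow> 'a \<Rightarrow> bool"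
  where "next_in r X j x \<longleftrightarrow> (j, x) \<in> r \<and> j \<noteq> x \<and> (\<forall>z\<in>X. (z, j) \<in> r \<or> (x, z) \<in> r)"

lemma next_in_exists:
  assumes lin: "linear_order_on X r" and "finite X" and "(j, z) \<in> r" "z \<noteq> j"
  obtains x where "next_in r X j x"
proof -
  define B where "B = {z \<in> X. (j, z) \<in> r \<and> z \<noteq> j}"
  \<comment> \<open>In the converse order, the least point strictly above \<open>j\<close> becomes a
    greatest one.\<close>
  have "linear_order_on X (r\<inverse>)" "finite B" "B \<noteq> {}" "B \<subseteq> X"
    using assms linear_order_on_mem[OF lin] by (auto simp: B_def)
  then obtain x where x: "x \<in> B" "\<And>z. z \<in> B \<Longrightarrow> (z, x) \<in> r\<inverse>"
    by (rule linear_order_on_greatest) blast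
  have "j \<in> X"
    using assms linear_order_on_mem[OF lin] by blast
  then have "(z, j) \<in> r \<or> (x, z) \<in> r" if "z \<in> X" for z
    using that x(2)[of z] linear_order_on_total[OF lin, of z j] linear_order_on_refl[OF lin]
    by (auto simp: B_def)
  then show ?thesis
    using that x by (auto simp: next_in_def B_def)
qed

section \<open>Geometries generated by two chains\<close>

locale two_orders =
  fixes X :: "'a set" and r :: "nat \<Rightarrow> ('a \<times> 'a) set"
  assumes finite: "finite X"
    and linear: "i \<in> {1, 2} \<Longrightarrow> linear_order_on X (r i)"
begin

abbreviation G :: "'a set gorder"
  where "G \<equiv> chain_geometry X 2 r"

abbreviation C :: "nat \<Rightarrow> 'a \<Rightarrow> 'a set"
  where "C i \<equiv> principal_segment X (r i)"

text \<open>The closure operator of the geometry: the intersection of the two initial segments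
  generated by \<open>A\<close>. The witnesses \<open>u\<close> for the two orders may
  differ.\<close>

definition hull :: "'a set \<Rightarrow> 'a set"
  where "hull A = {z \<in> X. \<forall>i\<in>{1, 2}. \<exists>u\<in>A. (z, u) \<in> r i}"

text \<open>The interval of the theorem (see \<open>interval_eq_fibre\<close>), phrased so that
  \<open>j\<close> is visibly the greatest element of each member in the order
  \<open>r i\<close>.\<close>

definition fibre :: "nat \<Rightarrow> 'a \<Rightarrow> 'a set set"
  where "fibre i j = {A \<in> carrier G. j \<in> A \<and> A \<subseteq> C i j}"

lemma rel_mem: "i \<in> {1, 2} \<Longrightarrow> (x, y) \<in> r i \<Longrightarrow> x \<in> X \<and> y \<in> X"
  using linear linear_order_on_mem by metis

lemma rel_refl: "i \<in> {1, 2} \<Longrightarrow> x \<in> X \<Longrightarrow> (x, x) \<in> r i"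
  using linear linear_order_on_refl by metis

lemma rel_trans: "i \<in> {1, 2} \<Longrightarrow> (x, y) \<in> r i \<Longrightarrow> (y, z) \<in> r i \<Longrightarrow> (x, z) \<in> r i"
  using linear linear_order_on_trans by metis

lemma rel_antisym: "i \<in> {1, 2} \<Longrightarrow> (x, y) \<in> r i \<Longrightarrow> (y, x) \<in> r i \<Longrightarrow> x = y"
  using linear linear_order_on_antisym by metis

lemma rel_total: "i \<in> {1, 2} \<Longrightarrow> x \<in> X \<Longrightarrow> y \<in> X \<Longrightarrow> (x, y) \<in> r i \<or> (y, x) \<in> r i"
  using linear linear_order_on_total by metis

lemma in_C_iff: "z \<in> C i y \<longleftrightarrow> z \<in> X \<and> (z, y) \<in> r i"
  by (simp add: principal_segment_def)

lemma C_subset_iff: "i \<in> {1, 2} \<Longrightarrow> x \<in> X \<Longrightarrow> y \<in> X \<Longrightarrow> C i x \<subseteq> C i y \<longleftrightarrow> (x, y) \<in> r i"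
  unfolding principal_segment_def using rel_refl[of i x] rel_trans[of i] by blast

lemma C_psubset_iff:
  "i \<in> {1, 2} \<Longrightarrow> x \<in> X \<Longrightarrow> y \<in> X \<Longrightarrow> C i x \<subset> C i y \<longleftrightarrow> (x, y) \<in> r i \<and> x \<noteq> y"
  using C_subset_iff[of i x y] C_subset_iff[of i y x] rel_antisym[of i x y] by (auto simp: psubset_eq)

section \<open>The closure operator and its closed sets\<close>

lemma hull_subset: "hull A \<subseteq> X"
  by (auto simp: hull_def)

lemma subset_hull: "A \<subseteq> X \<Longrightarrow> A \<subseteq> hull A"
  using rel_refl by (auto simp: hull_def)

lemma hull_mono: "A \<subseteq> B \<Longrightarrow> hull A \<subseteq> hull B"
  by (auto simp: hull_def)

lemma hull_hull: "hull (hull A) = hull A"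
proof
  show "hull (hull A) \<subseteq> hull A"
    unfolding hull_def using rel_trans by blast
  show "hull A \<subseteq> hull (hull A)"
    by (rule subset_hull[OF hull_subset])
qed

lemma carrier_eq:
  "carrier G = {\<Inter>F |F. F \<noteq> {} \<and> F \<subseteq> segment_chain X (r 1) \<union> segment_chain X (r 2)}"
proof -
  have "{1..2} = {1, 2::nat}"
    by auto
  then show ?thesis
    by (simp add: chain_geometry_def)
qed

text \<open>An initial segment that contains \<open>A\<close> contains every point below a point of
  \<open>A\<close> in its order, hence all of \<open>hull A\<close>; conversely
  \<open>hull A\<close> is itself an intersection of two initial segments.\<close>

lemma carrier_iff: "A \<in> carrier G \<longleftrightarrow> hull A = A"
proof
  assume "A \<in> carrier G"
  then obtain F where F: "F \<noteq> {}" "F \<subseteq> segment_chain X (r 1) \<union> segment_chain X (r 2)" "A = \<Inter>F"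
    unfolding carrier_eq by blast
  then obtain D where D: "D \<in> F"
    by blast
  then have "D \<subseteq> X"
    using F(2) unfolding segment_chain_def by blast
  then have sub: "A \<subseteq> X"
    using D F(3) by blast
  have "z \<in> D" if "z \<in> hull A" "D \<in> F" for z D
  proof -
    obtain i where "i \<in> {1, 2}" and D: "D \<in> segment_chain X (r i)"
      using F(2) \<open>D \<in> F\<close> by blast
    then obtain u where "z \<in> X" "u \<in> A" "(z, u) \<in> r i"
      using \<open>z \<in> hull A\<close> unfolding hull_def by blast
    then show ?thesis
      using D F(3) \<open>D \<in> F\<close> unfolding segment_chain_def by blast
  qed
  then show "hull A = A"
    using subset_hull[OF sub] F(3) by blast
next
  assume A: "hull A = A"
  define D where "D i = {z \<in> X. \<exists>u\<in>A. (z, u) \<in> r i}" for i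
  have "D i \<in> segment_chain X (r i)" if "i \<in> {1, 2}" for i
    unfolding segment_chain_def D_def using rel_trans[OF that] by blast
  then have "{D 1, D 2} \<subseteq> segment_chain X (r 1) \<union> segment_chain X (r 2)"
    by simp
  moreover have "\<Inter>{D 1, D 2} = hull A"
    unfolding hull_def D_def by blast
  ultimately have "hull A \<in> carrier G"
    unfolding carrier_eq by blast
  then show "A \<in> carrier G"
    by (simp add: A)
qed

lemma hull_carrier [simp]: "hull A \<in> carrier G"
  by (simp add: carrier_iff hull_hull)

lemma carrier_subset: "A \<in> carrier G \<Longrightarrow> A \<subseteq> X"
  using hull_subset[of A] by (simp add: carrier_iff)

lemma hull_least: "A \<subseteq> B \<Longrightarrow> B \<in> carrier G \<Longrightarrow> hull A \<subseteq> B"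
  using hull_mono[of A B] by (simp add: carrier_iff)

lemma hull_pair_iff:
  assumes "{i, i'} = {1, 2}"
  shows "z \<in> hull A \<longleftrightarrow> z \<in> X \<and> (\<exists>u\<in>A. (z, u) \<in> r i) \<and> (\<exists>v\<in>A. (z, v) \<in> r i')"
  unfolding hull_def assms[symmetric] by auto

lemma carrierD:
  assumes "{i, i'} = {1, 2}" "A \<in> carrier G" "u \<in> A" "(z, u) \<in> r i" "v \<in> A" "(z, v) \<in> r i'"
  shows "z \<in> A"
proof -
  have "z \<in> X"
    using assms rel_mem[of i z u] by auto
  then have "z \<in> hull A"
    using assms hull_pair_iff by blast
  then show ?thesis
    using assms(2) by (simp add: carrier_iff)
qed

lemma carrierI:
  assumes "{i, i'} = {1, 2}" "A \<subseteq> X"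
    and "\<And>z u v. u \<in> A \<Longrightarrow> (z, u) \<in> r i \<Longrightarrow> v \<in> A \<Longrightarrow> (z, v) \<in> r i' \<Longrightarrow> z \<in> A"
  shows "A \<in> carrier G"
proof -
  have "hull A \<subseteq> A"
    using assms(3) hull_pair_iff[OF assms(1)] by blast
  then show ?thesis
    using subset_hull[OF assms(2)] by (simp add: carrier_iff)
qed

lemma C_carrier: "i \<in> {1, 2} \<Longrightarrow> C i y \<in> carrier G"
proof -
  assume i: "i \<in> {1, 2}"
  have "hull (C i y) \<subseteq> C i y"
    unfolding hull_def principal_segment_def using i rel_trans[OF i] by blast
  moreover have "C i y \<subseteq> hull (C i y)"
    by (rule subset_hull) (auto simp: in_C_iff)
  ultimately show ?thesis
    by (simp add: carrier_iff)
qed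

lemma Int_carrier: "A \<in> carrier G \<Longrightarrow> B \<in> carrier G \<Longrightarrow> A \<inter> B \<in> carrier G"
  unfolding carrier_iff[of "A \<inter> B"]
  using hull_least[of "A \<inter> B" A] hull_least[of "A \<inter> B" B] subset_hull[of "A \<inter> B"] carrier_subset[of A]
  by blast

section \<open>Lattice operations of the geometry\<close>

lemma order_simps [simp]:
  "A \<sqsubseteq>\<^bsub>G\<^esub> B \<longleftrightarrow> A \<subseteq> B" "A .=\<^bsub>G\<^esub> B \<longleftrightarrow> A = B" "A \<sqsubset>\<^bsub>G\<^esub> B \<longleftrightarrow> A \<subset> B"
  by (auto simp: chain_geometry_def lless_def)

text \<open>\<open>inf\<close> chooses some greatest lower bound, so uniqueness has to accompany the
  fact that \<open>A \<inter> B\<close> is one.\<close>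

lemma meet_eq:
  assumes "A \<in> carrier G" "B \<in> carrier G"
  shows "A \<sqinter>\<^bsub>G\<^esub> B = A \<inter> B"
proof -
  have "greatest G (A \<inter> B) (Lower G {A, B})"
    using assms Int_carrier[OF assms] by (auto simp: greatest_def Lower_def)
  moreover from this have "D = A \<inter> B" if "greatest G D (Lower G {A, B})" for D
    using that by (intro subset_antisym) (simp_all add: greatest_def)
  ultimately show ?thesis
    unfolding meet_def inf_def by (rule some_equality)
qed

lemma join_eq:
  assumes "A \<in> carrier G" "B \<in> carrier G"
  shows "A \<squnion>\<^bsub>G\<^esub> B = hull (A \<union> B)"
proof -
  have "least G (hull (A \<union> B)) (Upper G {A, B})"
    using assms carrier_subset subset_hull[of "A \<union> B"] hull_least[of "A \<union> B"]
    by (auto simp: least_def Upper_def)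
  moreover from this have "D = hull (A \<union> B)" if "least G D (Upper G {A, B})" for D
    using that by (intro subset_antisym) (simp_all add: least_def)
  ultimately show ?thesis
    unfolding join_def sup_def by (rule some_equality)
qed

lemma bottom_eq: "\<bottom>\<^bsub>G\<^esub> = {}"
proof -
  have "{} \<in> carrier G"
    by (auto simp: carrier_iff hull_def)
  then have "least G D (carrier G) \<longleftrightarrow> D = {}" for D
    by (auto simp: least_def)
  then show ?thesis
    by (simp add: bottom_def)
qed

lemma top_eq: "\<top>\<^bsub>G\<^esub> = X"
proof -
  have "X \<in> carrier G"
    using subset_hull[of X] hull_subset[of X] by (auto simp: carrier_iff)
  then have "greatest G D (carrier G) \<longleftrightarrow> D = X" for D
    using carrier_subset by (auto simp: greatest_def)
  then show ?thesis
    by (simp add: top_def)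
qed

lemma sublattice_iff:
  "sublattice S G \<longleftrightarrow> S \<noteq> {} \<and> S \<subseteq> carrier G \<and> (\<forall>A\<in>S. \<forall>B\<in>S. A \<inter> B \<in> S \<and> hull (A \<union> B) \<in> S)"
proof -
  have "A \<sqinter>\<^bsub>G\<^esub> B = A \<inter> B" "A \<squnion>\<^bsub>G\<^esub> B = hull (A \<union> B)" if "S \<subseteq> carrier G" "A \<in> S" "B \<in> S" for A B
    using that meet_eq[of A B] join_eq[of A B] by auto
  then show ?thesis
    unfolding sublattice_def by (intro conj_cong ball_cong HOL.refl) simp_all
qed

section \<open>Point closures, intervals and covers in terms of the orders\<close>

lemma C_Int_C:
  assumes "{i, i'} = {1, 2}" "j \<in> X"
  shows "C i j \<inter> C i' j = hull {j}"
  using hull_pair_iff[OF assms(1)] by (auto simp: in_C_iff)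

lemma hull_singleton_subset_C: "i \<in> {1, 2} \<Longrightarrow> hull {j} \<subseteq> C i j"
  by (auto simp: hull_def in_C_iff)

lemma mem_hull_singleton: "j \<in> X \<Longrightarrow> j \<in> hull {j}"
  using subset_hull[of "{j}"] by auto

lemma point_closure_eq:
  assumes "j \<in> X"
  shows "point_closure G j = hull {j}"
  unfolding point_closure_def
  by (rule Least_equality) (use assms mem_hull_singleton hull_least[of "{j}"] in auto)

text \<open>Since \<open>hull {j} = C i j \<inter> C i' j\<close>, and a segment of
  \<open>r i'\<close> through \<open>j\<close> contains all of \<open>C i' j\<close>, membership in
  that chain means that the intersection is \<open>C i' j\<close>.\<close>

lemma hull_singleton_in_chain_iff:
  assumes "{i, i'} = {1, 2}" "j \<in> X"
  shows "hull {j} \<in> segment_chain X (r i') \<longleftrightarrow> C i' j \<subseteq> C i j"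
proof
  assume "hull {j} \<in> segment_chain X (r i')"
  then have "C i' j \<subseteq> hull {j}"
    using mem_hull_singleton[OF assms(2)] by (auto simp: segment_chain_def in_C_iff)
  then show "C i' j \<subseteq> C i j"
    using hull_singleton_subset_C[of i] assms by auto
next
  assume "C i' j \<subseteq> C i j"
  then have "hull {j} = C i' j"
    using C_Int_C[OF assms] by auto
  moreover have "C i' j \<in> segment_chain X (r i')"
    unfolding segment_chain_def principal_segment_def using rel_trans[of i'] assms(1) by blast
  ultimately show "hull {j} \<in> segment_chain X (r i')"
    by simp
qed

lemma interval_eq_fibre:
  assumes "j \<in> X"
  shows "\<lbrace>hull {j}..C i j\<rbrace>\<^bsub>G\<^esub> = fibre i j"
  using mem_hull_singleton[OF assms] hull_least[of "{j}"]
  by (auto simp: at_least_at_most_def fibre_def)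

text \<open>A point strictly between \<open>j\<close> and \<open>x\<close> would yield a principal
  segment strictly between; conversely \<open>C i x\<close> has just one point more than
  \<open>C i j\<close>, which leaves no room for any set in between.\<close>

lemma covered_by_iff_next_in:
  assumes i: "i \<in> {1, 2}" and "j \<in> X" "x \<in> X"
  shows "C i j \<prec>\<^bsub>G\<^esub> C i x \<longleftrightarrow> next_in (r i) X j x"
proof
  assume cov: "C i j \<prec>\<^bsub>G\<^esub> C i x"
  then have jx: "(j, x) \<in> r i" "j \<noteq> x"
    using C_psubset_iff[of i j x] assms by (auto simp: covered_by_def)
  have "(z, j) \<in> r i \<or> (x, z) \<in> r i" if "z \<in> X" for z
  proof (rule ccontr)
    assume "\<not> ((z, j) \<in> r i \<or> (x, z) \<in> r i)"
    then have "C i j \<subset> C i z" "C i z \<subset> C i x"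
      using that assms C_psubset_iff[OF i] rel_total[OF i] by metis+
    then show False
      using cov C_carrier[OF i, of z] by (auto simp: covered_by_def)
  qed
  then show "next_in (r i) X j x"
    using jx by (simp add: next_in_def)
next
  assume next_in: "next_in (r i) X j x"
  then have "C i j \<subset> C i x"
    using C_psubset_iff[of i j x] assms by (auto simp: next_in_def)
  moreover have "C i x \<subseteq> insert x (C i j)"
    using next_in rel_antisym[OF i] unfolding next_in_def principal_segment_def by blast
  then have "\<not> (C i j \<subset> A \<and> A \<subset> C i x)" for A
    by blast
  ultimately show "C i j \<prec>\<^bsub>G\<^esub> C i x"
    using C_carrier[OF i] by (simp add: covered_by_def)
qed

lemma next_in_mem: "i \<in> {1, 2} \<Longrightarrow> next_in (r i) X j x \<Longrightarrow> j \<in> X \<and> x \<in> X"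
  using rel_mem by (auto simp: next_in_def)

lemma next_in_less_iff:
  "i \<in> {1, 2} \<Longrightarrow> next_in (r i) X j x \<Longrightarrow> z \<in> X \<Longrightarrow> (x, z) \<in> r i \<longleftrightarrow> (z, j) \<notin> r i"
  using rel_trans[of i x z j] rel_antisym[of i x j] by (auto simp: next_in_def)

section \<open>Removing fibres\<close>

text \<open>The \<open>i\<close>-greatest element of a join is the larger of the two: the point of
  \<open>A \<union> B\<close> that puts \<open>j\<close> into the hull lies \<open>i\<close>-above
  \<open>j\<close> and also in \<open>C i j\<close>, so it is \<open>j\<close>.\<close>

lemma fibre_hull_Un:
  assumes "{i, i'} = {1, 2}" "A \<in> carrier G" "B \<in> carrier G" "hull (A \<union> B) \<in> fibre i j"
  shows "A \<in> fibre i j \<or> B \<in> fibre i j"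
proof -
  have i: "i \<in> {1, 2}"
    using assms(1) by auto
  have "A \<union> B \<subseteq> hull (A \<union> B)"
    using assms carrier_subset by (intro subset_hull) simp
  then have AB: "A \<union> B \<subseteq> C i j"
    using assms(4) unfolding fibre_def by blast
  have "j \<in> hull (A \<union> B)"
    using assms(4) by (simp add: fibre_def)
  then obtain u where u: "u \<in> A \<union> B" "(j, u) \<in> r i"
    using hull_pair_iff[OF assms(1)] by blast
  then have "u = j"
    using AB rel_antisym[OF i] in_C_iff by blast
  then show ?thesis
    using u AB assms by (auto simp: fibre_def)
qed

text \<open>Lets a sublattice recover \<open>A\<close> from the point closure of \<open>j\<close>
  and from \<open>A - {j}\<close>, which lies outside every fibre over \<open>j\<close>.\<close>

lemma hull_insert_Diff:
  assumes "A \<in> carrier G" "j \<in> A"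
  shows "hull (hull {j} \<union> (A - {j})) = A"
proof
  show "hull (hull {j} \<union> (A - {j})) \<subseteq> A"
    using assms hull_least[of "{j}" A] by (intro hull_least) auto
  have "A \<subseteq> hull {j} \<union> (A - {j})"
    using assms mem_hull_singleton carrier_subset by auto
  then show "A \<subseteq> hull (hull {j} \<union> (A - {j}))"
    using subset_hull[of "hull {j} \<union> (A - {j})"] hull_subset carrier_subset[OF assms(1)] by blast
qed

text \<open>\<open>j\<close> is an extreme point of \<open>A\<close>: for closure to put it back,
  some other point of \<open>A\<close> would have to be \<open>i\<close>-above it.\<close>

lemma Diff_carrier:
  assumes "{i, i'} = {1, 2}" "A \<in> fibre i j"
  shows "A - {j} \<in> carrier G"
proof (rule carrierI[OF assms(1)])
  show "A - {j} \<subseteq> X"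
    using assms carrier_subset by (auto simp: fibre_def)
next
  fix z u v
  have i: "i \<in> {1, 2}"
    using assms(1) by auto
  assume *: "u \<in> A - {j}" "(z, u) \<in> r i" "v \<in> A - {j}" "(z, v) \<in> r i'"
  then have "z \<in> A"
    using assms(2) carrierD[OF assms(1), of A u z v] by (simp add: fibre_def)
  moreover have "z \<noteq> j"
    using * assms(2) rel_antisym[OF i, of u j] by (auto simp: fibre_def in_C_iff)
  ultimately show "z \<in> A - {j}"
    by simp
qed

text \<open>The criterion behind all three forms: \<open>I\<close> is a singleton in forms (1) and
  (2) and \<open>{1, 2}\<close> in form (3). Assumption \<open>meet\<close> keeps the complement
  closed under meets; \<open>bot\<close> produces \<open>hull {j}\<close> from any single removed
  set, and from it all of \<open>D\<close> is regenerated.\<close>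

lemma maximal_sublattice_Diff:
  assumes j: "j \<in> X" and D: "D = (\<Union>i\<in>I. fibre i j)" and I: "I \<subseteq> {1, 2}" "I \<noteq> {}"
    and x: "x \<notin> (\<Union>i\<in>I. C i j)"
    and meet: "\<And>A. A \<in> carrier G \<Longrightarrow> j \<in> A \<Longrightarrow> A \<notin> D \<Longrightarrow> x \<in> A"
    and bot: "\<And>A. A \<in> D \<Longrightarrow> \<exists>B\<in>carrier G - D. A \<inter> B = hull {j}"
  shows "maximal_sublattice (carrier G - D) G"
proof -
  have sub: "D \<subseteq> carrier G"
    by (auto simp: D fibre_def)
  have j_in: "j \<in> A" if "A \<in> D" for A
    using that by (auto simp: D fibre_def)
  have x_notin: "x \<notin> A" if "A \<in> D" for A
    using that x by (auto simp: D fibre_def)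
  have empty: "{} \<in> carrier G - D"
    using j_in by (auto simp: carrier_iff hull_def)
  have pair: "\<exists>i'. {i, i'} = {1, 2}" if "i \<in> I" for i
    using that I by auto
  obtain i where "i \<in> I" "i \<in> {1, 2}"
    using I by blast
  then have ne: "hull {j} \<in> D"
    using hull_singleton_subset_C[of i j] mem_hull_singleton[OF j] unfolding D fibre_def
    by simp blast
  have "sublattice (carrier G - D) G"
    unfolding sublattice_iff
  proof (intro conjI ballI)
    fix A B
    assume A: "A \<in> carrier G - D" and B: "B \<in> carrier G - D"
    \<comment> \<open>If \<open>A \<inter> B\<close> were in \<open>D\<close>, both sets would
      contain \<open>j\<close> and hence \<open>x\<close>, but no member of \<open>D\<close>
      contains \<open>x\<close>.\<close>
    show "A \<inter> B \<in> carrier G - D"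
      using A B Int_carrier[of A B] j_in[of "A \<inter> B"] x_notin[of "A \<inter> B"] meet[of A] meet[of B] by auto
    show "hull (A \<union> B) \<in> carrier G - D"
    proof -
      have "hull (A \<union> B) \<notin> fibre i j" if "i \<in> I" for i
        using A B pair[OF that] fibre_hull_Un[of i _ A B j] that by (auto simp: D)
      then show ?thesis
        by (auto simp: D)
    qed
  qed (use empty in auto)
  moreover have "S = carrier G" if S: "sublattice S G" and less: "carrier G - D \<subset> S" for S
  proof -
    have closed: "A \<inter> B \<in> S" "hull (A \<union> B) \<in> S" if "A \<in> S" "B \<in> S" for A B
      using S that by (auto simp: sublattice_iff)
    obtain A where A: "A \<in> S" "A \<in> D"
      using less S by (auto simp: sublattice_iff)
    then obtain B where "B \<in> S" "A \<inter> B = hull {j}"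
      using bot[OF A(2)] less by blast
    then have hull_j: "hull {j} \<in> S"
      using closed(1)[of A B] A by simp
    have "B \<in> S" if "B \<in> D" for B
    proof -
      \<comment> \<open>This set is closed, and outside \<open>D\<close> because it omits
        \<open>j\<close>; so it already belongs to \<open>S\<close>.\<close>
      have "B - {j} \<in> carrier G"
        using that pair Diff_carrier unfolding D by blast
      then have "B - {j} \<in> S"
        using j_in[of "B - {j}"] less by auto
      then show ?thesis
        using closed(2)[OF hull_j, of "B - {j}"] hull_insert_Diff[of B j] that sub j_in by auto
    qed
    then show ?thesis
      using less S by (auto simp: sublattice_iff)
  qed
  ultimately show ?thesis
    using ne sub by (auto simp: maximal_sublattice_def)
qed

text \<open>Form (1). A closed set that contains \<open>j\<close> and leaves \<open>C i j\<close>
  has a point at or beyond \<open>x\<close> in the order \<open>i\<close>, and \<open>j\<close> lies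
  beyond \<open>x\<close> in the other order, so closedness gives \<open>x\<close>. The set meeting
  a removed one in \<open>hull {j}\<close> is \<open>C i' j\<close>, which survives because it
  contains \<open>x\<close>.\<close>

lemma maximal_sublattice_next_less:
  assumes ii: "{i, i'} = {1, 2}" and x: "next_in (r i) X j x" and less: "(x, j) \<in> r i'"
  shows "maximal_sublattice (carrier G - fibre i j) G"
proof -
  have i: "i \<in> {1, 2}" "i' \<in> {1, 2}"
    using ii by auto
  have jx: "j \<in> X" "x \<in> X"
    using next_in_mem[OF i(1) x] by auto
  have x_notin: "x \<notin> C i j"
    using next_in_less_iff[OF i(1) x, of x] rel_refl[OF i(1)] jx by (auto simp: in_C_iff)
  show ?thesis
  proof (rule maximal_sublattice_Diff[of j _ "{i}" x])
    fix A assume A: "A \<in> carrier G" "j \<in> A" "A \<notin> fibre i j"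
    then obtain u where "u \<in> A" "(x, u) \<in> r i"
      using carrier_subset next_in_less_iff[OF i(1) x] by (fastforce simp: fibre_def in_C_iff)
    then show "x \<in> A"
      using carrierD[OF ii A(1)] A(2) less by blast
  next
    fix A assume A: "A \<in> fibre i j"
    have "A \<inter> C i' j = hull {j}"
      using A C_Int_C[OF ii jx(1)] hull_least[of "{j}" A] by (auto simp: fibre_def)
    moreover have "C i' j \<notin> fibre i j"
      using x_notin less jx by (auto simp: fibre_def in_C_iff)
    ultimately show "\<exists>B\<in>carrier G - fibre i j. A \<inter> B = hull {j}"
      using C_carrier[OF i(2)] by blast
  qed (use i jx x_notin in auto)
qed

text \<open>Forms (2) and (3). By \<open>sub\<close>, a fibre over \<open>j\<close> whose index is
  not in \<open>I\<close> is contained in the other one, so both fibres are removed. A remaining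
  closed set through \<open>j\<close> thus exceeds \<open>j\<close> in both orders, reaches the
  common successor \<open>x\<close> in both, and contains it.\<close>

lemma maximal_sublattice_next_next:
  assumes x: "next_in (r 1) X j x" "next_in (r 2) X j x"
    and I: "I \<subseteq> {1, 2}" "I \<noteq> {}"
    and sub: "\<And>i i'. {i, i'} = {1, 2} \<Longrightarrow> i' \<notin> I \<Longrightarrow> C i' j \<subseteq> C i j"
  shows "maximal_sublattice (carrier G - (\<Union>i\<in>I. fibre i j)) G"
proof -
  have next_in: "next_in (r i) X j x" if "i \<in> {1, 2}" for i
    using that x by auto
  have jx: "j \<in> X" "x \<in> X"
    using next_in_mem[of 1 j x] x by auto
  have x_notin: "x \<notin> C i j" if "i \<in> {1, 2}" for i
    using next_in_less_iff[OF that next_in[OF that], of x] rel_refl[OF that] jx by (auto simp: in_C_iff)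
  have above: "\<exists>u\<in>A. (x, u) \<in> r i" if "A \<in> carrier G" "\<not> A \<subseteq> C i j" "i \<in> {1, 2}" for A i
    using that carrier_subset next_in_less_iff[OF that(3) next_in[OF that(3)]]
    by (fastforce simp: in_C_iff)
  show ?thesis
  proof (rule maximal_sublattice_Diff[of j _ I x])
    fix A assume A: "A \<in> carrier G" "j \<in> A" "A \<notin> (\<Union>i\<in>I. fibre i j)"
    have "\<not> A \<subseteq> C i j" if "i \<in> {1, 2}" for i
    proof
      assume le: "A \<subseteq> C i j"
      then have "i \<notin> I"
        using A by (auto simp: fibre_def)
      moreover have "\<exists>i'. {i, i'} = {1, 2}"
        using that by auto
      then obtain i' where "{i, i'} = {1, 2}" ..
      then have i': "{i', i} = {1, 2}"
        by (simp add: insert_commute)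
      ultimately have "i' \<in> I"
        using I by auto
      moreover have "A \<subseteq> C i' j"
        using le sub[OF i' \<open>i \<notin> I\<close>] by auto
      ultimately show False
        using A by (auto simp: fibre_def)
    qed
    then obtain u v where "u \<in> A" "(x, u) \<in> r 1" "v \<in> A" "(x, v) \<in> r 2"
      using above[OF A(1), of 1] above[OF A(1), of 2] by auto
    then show "x \<in> A"
      using carrierD[OF HOL.refl A(1)] by blast
  next
    fix A assume "A \<in> (\<Union>i\<in>I. fibre i j)"
    then obtain i where i: "i \<in> I" "A \<in> fibre i j"
      by auto
    then obtain i' where ii: "{i, i'} = {1, 2}"
      using I by auto
    have i12: "i \<in> {1, 2}" "i' \<in> {1, 2}"
      using ii by auto
    have "x \<notin> A"
      using i x_notin[OF i12(1)] by (auto simp: fibre_def)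
    \<comment> \<open>\<open>C i' j\<close> may itself have been removed, so \<open>C i' x\<close>
      takes its place: it adds only \<open>x\<close>, which is not in \<open>A\<close>.\<close>
    have "C i' x \<subseteq> insert x (C i' j)"
      using next_in[OF i12(2)] rel_antisym[OF i12(2)] unfolding next_in_def principal_segment_def by blast
    then have "A \<inter> C i' x \<subseteq> C i j \<inter> C i' j"
      using i \<open>x \<notin> A\<close> by (auto simp: fibre_def)
    moreover have "j \<in> C i' x"
      using next_in[OF i12(2)] jx by (auto simp: next_in_def in_C_iff)
    ultimately have "A \<inter> C i' x = hull {j}"
      using i C_Int_C[OF ii jx(1)] hull_least[of "{j}" "A \<inter> C i' x"] Int_carrier C_carrier[OF i12(2)]
      by (auto simp: fibre_def)
    moreover have "x \<in> C i' x"
      using rel_refl[OF i12(2)] jx by (simp add: in_C_iff)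
    then have "C i' x \<notin> (\<Union>i\<in>I. fibre i j)"
      using x_notin I by (auto simp: fibre_def)
    ultimately show "\<exists>B\<in>carrier G - (\<Union>i\<in>I. fibre i j). A \<inter> B = hull {j}"
      by (intro bexI[of _ "C i' x"] DiffI C_carrier[OF i12(2)])
  qed (use I jx x_notin in auto)
qed

section \<open>Sublattices meeting all removable sets\<close>

text \<open>Here \<open>hull {j} = X\<close>, so proper closed sets omit \<open>j\<close>, and the
  closed set \<open>X - {j}\<close> is the largest of them. This excludes a point last in both
  orders when there are two coatoms.\<close>

lemma greatest_in_both_coatoms:
  assumes last: "\<And>i z. i \<in> {1, 2} \<Longrightarrow> z \<in> X \<Longrightarrow> (z, j) \<in> r i" and j: "j \<in> X"
  shows "coatoms G \<subseteq> {X - {j}}"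
proof
  fix A assume "A \<in> coatoms G"
  then have A: "A \<in> carrier G" "A \<subset> X" "\<And>B. B \<in> carrier G \<Longrightarrow> A \<subset> B \<Longrightarrow> \<not> B \<subset> X"
    by (auto simp: coatoms_def covered_by_def top_eq)
  have "hull {j} = X"
    using last hull_subset by (auto simp: hull_def)
  then have "j \<notin> A"
    using A hull_least[of "{j}" A] by auto
  moreover have "X \<subseteq> C 1 j"
    using last[of 1] by (auto simp: in_C_iff)
  then have "X \<in> fibre 1 j"
    using j carrier_iff[of X] subset_hull[of X] hull_subset[of X] by (auto simp: fibre_def)
  then have "X - {j} \<in> carrier G"
    using Diff_carrier[of 1 2] by auto
  ultimately show "A \<in> {X - {j}}"
    using A(2) A(3)[of "X - {j}"] j by auto
qed

lemma atomD:
  assumes "A \<in> atoms G"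
  shows "A \<in> carrier G" "A \<noteq> {}" "B \<in> carrier G \<Longrightarrow> B \<noteq> {} \<Longrightarrow> B \<subseteq> A \<Longrightarrow> B = A"
  using assms by (auto simp: atoms_def covered_by_def bottom_eq psubset_eq)

lemma atom_eq_hull_singleton:
  assumes A: "A \<in> atoms G"
  obtains a where "a \<in> X" "A = hull {a}"
proof -
  obtain a where a: "a \<in> A"
    using atomD(2)[OF A] by auto
  then have "a \<in> X"
    using atomD(1)[OF A] carrier_subset by auto
  moreover have "hull {a} = A"
    using a mem_hull_singleton[OF \<open>a \<in> X\<close>] hull_least[of "{a}", OF _ atomD(1)[OF A]]
    by (intro atomD(3)[OF A]) auto
  ultimately show ?thesis
    using that by auto
qed

lemma distinct_atoms_Int:
  assumes "A \<in> atoms G" "B \<in> atoms G" "A \<noteq> B"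
  shows "A \<inter> B = {}"
  using atomD(3)[OF assms(1), of "A \<inter> B"] atomD(3)[OF assms(2), of "A \<inter> B"]
    Int_carrier[OF atomD(1)[OF assms(1)] atomD(1)[OF assms(2)]] assms(3) by blast

text \<open>A closed set is the hull of its finitely many points, hence a join of point closures;
  \<open>{}\<close> serves as the empty join.\<close>

lemma hull_singletons_generate:
  assumes S: "sublattice S G" and empty: "{} \<in> S" and sing: "\<And>j. j \<in> X \<Longrightarrow> hull {j} \<in> S"
  shows "S = carrier G"
proof
  show "S \<subseteq> carrier G"
    using S by (simp add: sublattice_iff)
  show "carrier G \<subseteq> S"
  proof
    fix A assume A: "A \<in> carrier G"
    have "hull B \<in> S" if "finite B" "B \<subseteq> X" for B
      using that
    proof (induction B)
      case empty
      have "hull {} = {}"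
        by (auto simp: hull_def)
      then show ?case
        using \<open>{} \<in> S\<close> by simp
    next
      case (insert b B)
      have "hull (hull {b} \<union> hull B) = hull (insert b B)"
      proof
        show "hull (hull {b} \<union> hull B) \<subseteq> hull (insert b B)"
          using hull_mono[of "{b}" "insert b B"] hull_mono[of B "insert b B"]
          by (intro hull_least) auto
        show "hull (insert b B) \<subseteq> hull (hull {b} \<union> hull B)"
          using insert.prems subset_hull[of B] mem_hull_singleton[of b] by (intro hull_mono) auto
      qed
      moreover have "hull (hull {b} \<union> hull B) \<in> S"
        using S sing insert by (auto simp: sublattice_iff)
      ultimately show ?case
        by simp
    qed
    then show "A \<in> S"
      using A carrier_subset finite finite_subset carrier_iff by metis
  qed
qed

text \<open>The induction step. As \<open>j\<close> lies below \<open>x\<close> in both orders,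
  \<open>B\<close> contains \<open>j\<close>; intersecting with \<open>A\<close> removes the
  \<open>i\<close>-greatest element \<open>x\<close>, and its immediate predecessor \<open>j\<close>
  becomes greatest.\<close>

lemma meets_fibre_next_less:
  assumes ii: "{i, i'} = {1, 2}" and x: "next_in (r i) X j x" and jx: "(j, x) \<in> r i'"
    and S: "\<And>A B. A \<in> S \<Longrightarrow> B \<in> S \<Longrightarrow> A \<inter> B \<in> S" "S \<subseteq> carrier G"
    and B: "B \<in> S" "B \<in> fibre i x"
    and A: "A \<in> S" "j \<in> A" "x \<notin> A"
  shows "S \<inter> fibre i j \<noteq> {}"
proof -
  have i: "i \<in> {1, 2}"
    using ii by auto
  have "j \<in> B"
    using B carrierD[OF ii, of B x j x] jx x by (auto simp: fibre_def next_in_def)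
  moreover have "B \<subseteq> insert x (C i j)"
  proof
    fix z assume "z \<in> B"
    then have "z \<in> X" "(z, x) \<in> r i"
      using B by (auto simp: fibre_def in_C_iff)
    then show "z \<in> insert x (C i j)"
      using next_in_less_iff[OF i x, of z] rel_antisym[OF i, of z x] by (auto simp: in_C_iff)
  qed
  ultimately have "A \<inter> B \<in> fibre i j"
    using A B S Int_carrier[of A B] by (auto simp: fibre_def)
  then show ?thesis
    using A B S by auto
qed

text \<open>\<open>form23\<close> provides one of the two fibres over \<open>j\<close> without
  saying which. Downward induction, run on the \<open>i\<close>-greatest \<open>j\<close> whose
  fibre is missed, settles it for each index.\<close>

lemma sublattice_meets_fibres:
  assumes S: "\<And>A B. A \<in> S \<Longrightarrow> B \<in> S \<Longrightarrow> A \<inter> B \<in> S" "S \<subseteq> carrier G"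
    and last: "\<And>j. j \<in> X \<Longrightarrow> \<exists>i\<in>{1, 2}. \<exists>z\<in>X. (z, j) \<notin> r i"
    and form1: "\<And>i i' j x. {i, i'} = {1, 2} \<Longrightarrow> next_in (r i) X j x \<Longrightarrow> (x, j) \<in> r i' \<Longrightarrow>
      S \<inter> fibre i j \<noteq> {}"
    and form23: "\<And>j x. next_in (r 1) X j x \<Longrightarrow> next_in (r 2) X j x \<Longrightarrow>
      S \<inter> (fibre 1 j \<union> fibre 2 j) \<noteq> {}"
    and ii: "{i, i'} = {1, 2}" and j: "j \<in> X"
  shows "S \<inter> fibre i j \<noteq> {}"
proof (rule ccontr)
  have i: "i \<in> {1, 2}" "i' \<in> {1, 2}" and ii': "{i', i} = {1, 2}"
    using ii by auto
  define N where "N = {j \<in> X. S \<inter> fibre i j = {}}"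
  assume "\<not> S \<inter> fibre i j \<noteq> {}"
  then have "finite N" "N \<noteq> {}" "N \<subseteq> X"
    using j finite by (auto simp: N_def)
  then obtain j where j: "j \<in> N" "\<And>z. z \<in> N \<Longrightarrow> (z, j) \<in> r i"
    using linear_order_on_greatest[OF linear[OF i(1)]] by metis
  then have jX: "j \<in> X" and no: "S \<inter> fibre i j = {}"
    by (auto simp: N_def)
  show False
  proof (cases "\<exists>z\<in>X. (z, j) \<notin> r i")
    case False
    \<comment> \<open>\<open>j\<close> is last in the order \<open>i\<close>, so form (1) applies
      with the two orders exchanged, and the member of \<open>fibre i' j\<close> that it gives lies
      in \<open>C i j\<close> automatically.\<close>
    then obtain z where z: "z \<in> X" "(z, j) \<notin> r i'"
      using last[OF jX] ii by (metis insert_iff empty_iff)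
    then obtain y where y: "next_in (r i') X j y"
      using next_in_exists[OF linear[OF i(2)] finite, of j z] rel_total[OF i(2), of z j] rel_refl[OF i(2)] jX
      by metis
    then have "y \<in> X"
      using next_in_mem[OF i(2)] by auto
    then obtain A where "A \<in> S" "A \<in> fibre i' j"
      using form1[OF ii' y] False by auto
    moreover have "A \<subseteq> C i j"
      using False carrier_subset[of A] subsetD[OF S(2) \<open>A \<in> S\<close>] by (auto simp: in_C_iff)
    ultimately show False
      using no by (auto simp: fibre_def)
  next
    case True
    then obtain x where x: "next_in (r i) X j x"
      using next_in_exists[OF linear[OF i(1)] finite, of j] rel_total[OF i(1), of _ j] rel_refl[OF i(1)] jX
      by metis
    have xX: "x \<in> X" and "(x, j) \<notin> r i"
      using next_in_mem[OF i(1) x] next_in_less_iff[OF i(1) x, of x] rel_refl[OF i(1)] by auto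
    then have "x \<notin> N"
      using j(2) by auto
    then obtain B where B: "B \<in> S" "B \<in> fibre i x"
      using xX by (auto simp: N_def)
    \<comment> \<open>\<open>fibre i j\<close> is missed, so form (1) cannot apply at
      \<open>j\<close>; hence \<open>x\<close> lies above \<open>j\<close> in both orders.\<close>
    have "(x, j) \<notin> r i'"
      using form1[OF ii x] no by auto
    then have jx: "(j, x) \<in> r i'" "j \<noteq> x"
      using rel_total[OF i(2) jX xX] rel_refl[OF i(2) jX] by auto
    have contra: False if "A \<in> S" "j \<in> A" "x \<notin> A" for A
      using meets_fibre_next_less[OF ii x jx(1) S B that] no by simp
    \<comment> \<open>It remains to find a member of \<open>S\<close> separating \<open>j\<close> from \<open>x\<close>. Stepping from \<open>j\<close> to \<open>x\<close> in the
      order \<open>i'\<close>, at the \<open>i\<close>-greatest point \<open>y\<close> before \<open>x\<close> one of the three forms applies.\<close>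
    define Y where "Y = {y \<in> X. (j, y) \<in> r i' \<and> (x, y) \<notin> r i'}"
    have jY: "j \<in> Y"
      using jX rel_refl[OF i(2)] \<open>(x, j) \<notin> r i'\<close> by (simp add: Y_def)
    have "finite Y" "Y \<noteq> {}" "Y \<subseteq> X"
      using finite jY by (auto simp: Y_def)
    then obtain y where y: "y \<in> Y" "\<And>z. z \<in> Y \<Longrightarrow> (z, y) \<in> r i"
      using linear_order_on_greatest[OF linear[OF i(1)]] by metis
    then have yX: "y \<in> X" "(j, y) \<in> r i'" "(x, y) \<notin> r i'" "(y, x) \<in> r i'" "y \<noteq> x" "(j, y) \<in> r i"
      using jY rel_total[OF i(2), of x y] xX rel_refl[OF i(2)] by (auto simp: Y_def)
    obtain z where z: "next_in (r i') X y z"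
      using next_in_exists[OF linear[OF i(2)] finite yX(4)] yX(5) by metis
    have zX: "z \<in> X" "(y, z) \<in> r i'" "(z, x) \<in> r i'" "z \<noteq> y"
      using next_in_mem[OF i(2) z] next_in_less_iff[OF i(2) z xX] z rel_antisym[OF i(2), of z y] yX
      by (auto simp: next_in_def)
    show False
    proof (cases "(z, y) \<in> r i")
      case True
      \<comment> \<open>Form (1) for \<open>i'\<close> at \<open>y\<close>: \<open>A\<close> has
        \<open>i'\<close>-greatest element \<open>y\<close>, so it contains \<open>j\<close>, which
        is below \<open>y\<close> in both orders, and misses \<open>x\<close>, which is strictly
        \<open>i'\<close>-above \<open>y\<close>.\<close>
      then obtain A where A: "A \<in> S" "A \<in> fibre i' y"
        using form1[OF ii' z] by auto
      then have "j \<in> A" "x \<notin> A"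
        using carrierD[OF ii, of A y j y] yX by (auto simp: fibre_def in_C_iff)
      then show False
        using contra A by blast
    next
      case False
      \<comment> \<open>\<open>z\<close> is \<open>i\<close>-above \<open>y\<close>, hence outside
        \<open>Y\<close> by the choice of \<open>y\<close>; being \<open>i'\<close>-between
        \<open>y\<close> and \<open>x\<close>, it is \<open>x\<close>. Then \<open>y\<close>
        precedes \<open>x\<close> in the order \<open>i\<close>, so \<open>y = j\<close>, and
        \<open>x\<close> succeeds \<open>j\<close> in both orders.\<close>
      then have "z \<notin> Y"
        using y by auto
      then have "z = x"
        using zX rel_trans[OF i(2) yX(2) zX(2)] rel_antisym[OF i(2), of z x] by (auto simp: Y_def)
      then have "(y, j) \<in> r i"
        using False next_in_less_iff[OF i(1) x yX(1)] rel_total[OF i(1) zX(1) yX(1)] by auto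
      then have "y = j"
        using rel_antisym[OF i(1)] yX by blast
      then have x': "next_in (r i') X j x"
        using z \<open>z = x\<close> by simp
      have "S \<inter> (fibre i j \<union> fibre i' j) \<noteq> {}"
        using form23[of j x] x x' ii by (auto simp: doubleton_eq_iff)
      then obtain A where A: "A \<in> S" "A \<in> fibre i' j"
        using no by auto
      then have "j \<in> A" "x \<notin> A"
        using \<open>(x, j) \<notin> r i'\<close> by (auto simp: fibre_def in_C_iff)
      then show False
        using contra A by blast
    qed
  qed
qed

text \<open>Two coatoms exclude a point that is last in both orders, as the induction on fibres
  requires; two atoms put \<open>{}\<close> into \<open>S\<close>, as their meet.\<close>

lemma sublattice_eq_carrier:
  assumes S: "sublattice S G"
    and atoms: "card (atoms G) \<ge> 2" and coatoms: "card (coatoms G) \<ge> 2"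
    and form1: "\<And>i i' j x. {i, i'} = {1, 2} \<Longrightarrow> next_in (r i) X j x \<Longrightarrow> (x, j) \<in> r i' \<Longrightarrow>
      S \<inter> fibre i j \<noteq> {}"
    and form23: "\<And>j x. next_in (r 1) X j x \<Longrightarrow> next_in (r 2) X j x \<Longrightarrow>
      S \<inter> (fibre 1 j \<union> fibre 2 j) \<noteq> {}"
  shows "S = carrier G"
proof -
  have S_Int: "A \<inter> B \<in> S" if "A \<in> S" "B \<in> S" for A B
    using S that by (simp add: sublattice_iff)
  have S_sub: "S \<subseteq> carrier G"
    using S by (simp add: sublattice_iff)
  have last: "\<exists>i\<in>{1, 2}. \<exists>z\<in>X. (z, j) \<notin> r i" if "j \<in> X" for j
  proof (rule ccontr)
    assume "\<not> ?thesis"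
    then have "coatoms G \<subseteq> {X - {j}}"
      using greatest_in_both_coatoms that by blast
    then have "card (coatoms G) \<le> 1"
      using card_mono[of "{X - {j}}" "coatoms G"] by simp
    then show False
      using coatoms by simp
  qed
  have sing: "hull {j} \<in> S" if j: "j \<in> X" for j
  proof -
    have meets: "S \<inter> fibre i j \<noteq> {}" if "{i, i'} = {1, 2}" for i i'
      by (rule sublattice_meets_fibres[OF S_Int S_sub last form1 form23 that j])
    obtain A B where AB: "A \<in> S" "A \<in> fibre 1 j" "B \<in> S" "B \<in> fibre 2 j"
      using meets[of 1 2] meets[of 2 1] by auto
    \<comment> \<open>With \<open>j\<close> greatest in \<open>A\<close> for one order and in
      \<open>B\<close> for the other, their meet is squeezed down to the point closure.\<close>
    have "A \<inter> B \<subseteq> C 1 j \<inter> C 2 j"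
      using AB by (auto simp: fibre_def)
    then have "A \<inter> B = hull {j}"
      using AB C_Int_C[of 1 2 j] j hull_least[of "{j}" A] hull_least[of "{j}" B]
      by (auto simp: fibre_def)
    then show ?thesis
      using S_Int[of A B] AB by simp
  qed
  obtain T where "T \<subseteq> atoms G" "card T = 2"
    using obtain_subset_with_card_n[OF atoms] by metis
  then obtain A B where AB: "A \<in> atoms G" "B \<in> atoms G" "A \<noteq> B"
    by (auto simp: card_2_iff)
  then have "A \<in> S" "B \<in> S"
    using atom_eq_hull_singleton sing by metis+
  then have "{} \<in> S"
    using S_Int[of A B] distinct_atoms_Int[OF AB] by simp
  then show ?thesis
    using hull_singletons_generate[OF S] sing by blast
qed

text \<open>The three forms of the theorem in terms of the orders: a cover becomes
  \<open>next_in\<close>, and membership of the point closure in a chain becomes an inclusion of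
  principal segments. Strictness in form (1) comes from \<open>j \<noteq> x\<close> in
  \<open>next_in\<close>.\<close>

definition removable :: "'a set set set"
  where "removable =
    {fibre i j |i i' j. {i, i'} = {1, 2} \<and> (\<exists>x. next_in (r i) X j x \<and> (x, j) \<in> r i')} \<union>
    {fibre i j |i i' j. {i, i'} = {1, 2} \<and> C i' j \<subseteq> C i j \<and>
      (\<exists>x. next_in (r 1) X j x \<and> next_in (r 2) X j x)} \<union>
    {fibre 1 j \<union> fibre 2 j |j. \<not> C 1 j \<subseteq> C 2 j \<and> \<not> C 2 j \<subseteq> C 1 j \<and>
      (\<exists>x. next_in (r 1) X j x \<and> next_in (r 2) X j x)}"

lemma maximal_sublattice_removable:
  assumes "D \<in> removable"
  shows "maximal_sublattice (carrier G - D) G" "D \<subseteq> carrier G"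
proof -
  show "D \<subseteq> carrier G"
    using assms by (auto simp: removable_def fibre_def)
  show "maximal_sublattice (carrier G - D) G"
    using assms unfolding removable_def
  proof (elim UnE, goal_cases)
    case 1
    then obtain i i' j x where "{i, i'} = {1, 2}" "next_in (r i) X j x" "(x, j) \<in> r i'" "D = fibre i j"
      by blast
    then show ?thesis
      using maximal_sublattice_next_less by simp
  next
    case 2
    then obtain i i' j x where "{i, i'} = {1, 2}" "C i' j \<subseteq> C i j" "next_in (r 1) X j x"
      "next_in (r 2) X j x" "D = fibre i j"
      by blast
    then show ?thesis
      using maximal_sublattice_next_next[of j x "{i}"] by (auto simp: doubleton_eq_iff)
  next
    case 3
    then obtain j x where "next_in (r 1) X j x" "next_in (r 2) X j x" "D = fibre 1 j \<union> fibre 2 j"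
      by blast
    then show ?thesis
      using maximal_sublattice_next_next[of j x "{1, 2}"] by (auto simp: doubleton_eq_iff)
  qed
qed

lemma sublattice_disjoint_removable:
  assumes S: "sublattice S G" "S \<noteq> carrier G"
    and card: "card (atoms G) \<ge> 2" "card (coatoms G) \<ge> 2"
  obtains D where "D \<in> removable" "S \<inter> D = {}"
proof (rule ccontr)
  assume "\<not> thesis"
  then have meets: "S \<inter> D \<noteq> {}" if "D \<in> removable" for D
    using that \<open>\<And>D. D \<in> removable \<Longrightarrow> S \<inter> D = {} \<Longrightarrow> thesis\<close> by blast
  have "S \<inter> fibre i j \<noteq> {}" if "{i, i'} = {1, 2}" "next_in (r i) X j x" "(x, j) \<in> r i'" for i i' j x
    using that by (intro meets) (auto simp: removable_def)
  moreover have "S \<inter> (fibre 1 j \<union> fibre 2 j) \<noteq> {}"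
    if x: "next_in (r 1) X j x" "next_in (r 2) X j x" for j x
  proof -
    \<comment> \<open>How \<open>C 1 j\<close> and \<open>C 2 j\<close> compare decides between
      forms (2) and (3); in each case the removable set is contained in the union of the two
      fibres.\<close>
    have "fibre 1 j \<in> removable" if "C 2 j \<subseteq> C 1 j"
      unfolding removable_def using x that by blast
    moreover have "fibre 2 j \<in> removable" if "C 1 j \<subseteq> C 2 j"
      unfolding removable_def using x that insert_commute[of "2::nat" 1 "{}"] by blast
    moreover have "fibre 1 j \<union> fibre 2 j \<in> removable" if "\<not> C 2 j \<subseteq> C 1 j" "\<not> C 1 j \<subseteq> C 2 j"
      unfolding removable_def using x that by blast
    ultimately show ?thesis
      using meets by blast
  qed
  ultimately show False
    using sublattice_eq_carrier[OF S(1) card] S(2) by blast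
qed

text \<open>Every proper sublattice misses some removable \<open>D\<close>, so a maximal one lies
  inside the proper sublattice \<open>carrier G - D\<close> and equals it.\<close>

lemma complements_of_maximal_sublattices:
  assumes card: "card (atoms G) \<ge> 2" "card (coatoms G) \<ge> 2"
  shows "{carrier G - M |M. maximal_sublattice M G} = removable"
proof
  show "removable \<subseteq> {carrier G - M |M. maximal_sublattice M G}"
  proof
    fix D assume "D \<in> removable"
    then have "maximal_sublattice (carrier G - D) G" "D = carrier G - (carrier G - D)"
      using maximal_sublattice_removable by auto
    then show "D \<in> {carrier G - M |M. maximal_sublattice M G}"
      by blast
  qed
  show "{carrier G - M |M. maximal_sublattice M G} \<subseteq> removable"
  proof clarify
    fix M assume M: "maximal_sublattice M G"
    then obtain D where D: "D \<in> removable" "M \<inter> D = {}"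
      using sublattice_disjoint_removable[OF _ _ card] by (auto simp: maximal_sublattice_def)
    have "M \<subseteq> carrier G - D"
      using M D by (auto simp: maximal_sublattice_def sublattice_def)
    then have "M = carrier G - D"
      using M maximal_sublattice_removable(1)[OF D(1)] by (auto simp: maximal_sublattice_def)
    then have "carrier G - M = D"
      using maximal_sublattice_removable(2)[OF D(1)] by auto
    then show "carrier G - M \<in> removable"
      using D by simp
  qed
qed

end

section \<open>Translation from the orders back to the lattice\<close>

theorem theorem6p1:
  fixes X :: "'a set" and r :: "nat \<Rightarrow> ('a \<times> 'a) set" and G :: "'a set gorder"
    and C :: "nat \<Rightarrow> 'a \<Rightarrow> 'a set"
  assumes "finite X"
    and "\<And>i. i \<in> {1, 2} \<Longrightarrow> linear_order_on X (r i)"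
    and "G = chain_geometry X 2 r"
    and "cdim X G = 2"
    and "card (atoms G) \<ge> 2"
    and "card (coatoms G) \<ge> 2"
    and "\<And>i. C i = principal_segment X (r i)"
  shows "{carrier G - M |M. maximal_sublattice M G} =
      {\<lbrace>point_closure G j..C i j\<rbrace>\<^bsub>G\<^esub> |i i' j. {i, i'} = {1, 2} \<and> j \<in> X \<and>
        (\<exists>x\<in>X. C i j \<prec>\<^bsub>G\<^esub> C i x \<and> C i' x \<sqsubset>\<^bsub>G\<^esub> C i' j)} \<union>
      {\<lbrace>point_closure G j..C i j\<rbrace>\<^bsub>G\<^esub> |i i' j. {i, i'} = {1, 2} \<and> j \<in> X \<and>
        point_closure G j \<in> segment_chain X (r i') \<and>
        (\<exists>x\<in>X. C 1 j \<prec>\<^bsub>G\<^esub> C 1 x \<and> C 2 j \<prec>\<^bsub>G\<^esub> C 2 x)} \<union>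
      {\<lbrace>point_closure G j..C 1 j\<rbrace>\<^bsub>G\<^esub> \<union> \<lbrace>point_closure G j..C 2 j\<rbrace>\<^bsub>G\<^esub> |j. j \<in> X \<and>
        point_closure G j \<notin> segment_chain X (r 1) \<and>
        point_closure G j \<notin> segment_chain X (r 2) \<and>
        (\<exists>x\<in>X. C 1 j \<prec>\<^bsub>G\<^esub> C 1 x \<and> C 2 j \<prec>\<^bsub>G\<^esub> C 2 x)}
    \<and> (\<forall>i i' j x. {i, i'} = {1, 2} \<and> j \<in> X \<and> x \<in> X \<and>
        C i j \<prec>\<^bsub>G\<^esub> C i x \<and> C i' x \<sqsubset>\<^bsub>G\<^esub> C i' j \<longrightarrow>
        point_closure G j \<notin> segment_chain X (r i'))"
proof -
  interpret two_orders X r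
    by unfold_locales (use assms(1,2) in auto)
  have C: "C i = principal_segment X (r i)" for i
    by (fact assms(7))
  have G: "G = chain_geometry X 2 r"
    by (fact assms(3))
  have cover: "(\<exists>x\<in>X. C i j \<prec>\<^bsub>G\<^esub> C i x \<and> C i' x \<sqsubset>\<^bsub>G\<^esub> C i' j) \<longleftrightarrow>
      (\<exists>x. next_in (r i) X j x \<and> (x, j) \<in> r i')" if "{i, i'} = {1, 2}" "j \<in> X" for i i' j
  proof -
    have i: "i \<in> {1, 2}" "i' \<in> {1, 2}"
      using that by auto
    show ?thesis
      unfolding C G using covered_by_iff_next_in[OF i(1) that(2)] C_psubset_iff[OF i(2) _ that(2)]
        next_in_mem[OF i(1), of j] by (auto simp: next_in_def)
  qed
  have cover2: "(\<exists>x\<in>X. C 1 j \<prec>\<^bsub>G\<^esub> C 1 x \<and> C 2 j \<prec>\<^bsub>G\<^esub> C 2 x) \<longleftrightarrow>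
      (\<exists>x. next_in (r 1) X j x \<and> next_in (r 2) X j x)" if "j \<in> X" for j
    unfolding C G using covered_by_iff_next_in[of 1 j] covered_by_iff_next_in[of 2 j] that
      next_in_mem[of 1 j] by auto
  have chain: "point_closure G j \<in> segment_chain X (r i') \<longleftrightarrow> C i' j \<subseteq> C i j"
    if "{i, i'} = {1, 2}" "j \<in> X" for i i' j
    unfolding C G using point_closure_eq hull_singleton_in_chain_iff that by simp
  have chain12: "point_closure G j \<in> segment_chain X (r 1) \<longleftrightarrow> C 1 j \<subseteq> C 2 j"
    "point_closure G j \<in> segment_chain X (r 2) \<longleftrightarrow> C 2 j \<subseteq> C 1 j" if "j \<in> X" for j
    using chain[of 2 1 j] chain[of 1 2 j] that by auto
  have interval: "\<lbrace>point_closure G j..C i j\<rbrace>\<^bsub>G\<^esub> = fibre i j" if "j \<in> X" for i j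
    unfolding C G using point_closure_eq interval_eq_fibre that by simp
  \<comment> \<open>The sets in \<open>removable\<close> do not mention \<open>j \<in> X\<close>; it
    comes from \<open>next_in\<close>.\<close>
  have mem1: "j \<in> X" if "{i, i'} = {1, 2}" "next_in (r i) X j x" for i i' j x
    using next_in_mem[of i j x] that by auto
  have "{carrier G - M |M. maximal_sublattice M G} = removable"
    unfolding G by (rule complements_of_maximal_sublattices) (use assms(5,6) in \<open>simp_all add: G\<close>)
  also have "removable =
      {\<lbrace>point_closure G j..C i j\<rbrace>\<^bsub>G\<^esub> |i i' j. {i, i'} = {1, 2} \<and> j \<in> X \<and>
        (\<exists>x\<in>X. C i j \<prec>\<^bsub>G\<^esub> C i x \<and> C i' x \<sqsubset>\<^bsub>G\<^esub> C i' j)} \<union>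
      {\<lbrace>point_closure G j..C i j\<rbrace>\<^bsub>G\<^esub> |i i' j. {i, i'} = {1, 2} \<and> j \<in> X \<and>
        point_closure G j \<in> segment_chain X (r i') \<and>
        (\<exists>x\<in>X. C 1 j \<prec>\<^bsub>G\<^esub> C 1 x \<and> C 2 j \<prec>\<^bsub>G\<^esub> C 2 x)} \<union>
      {\<lbrace>point_closure G j..C 1 j\<rbrace>\<^bsub>G\<^esub> \<union> \<lbrace>point_closure G j..C 2 j\<rbrace>\<^bsub>G\<^esub> |j. j \<in> X \<and>
        point_closure G j \<notin> segment_chain X (r 1) \<and>
        point_closure G j \<notin> segment_chain X (r 2) \<and>
        (\<exists>x\<in>X. C 1 j \<prec>\<^bsub>G\<^esub> C 1 x \<and> C 2 j \<prec>\<^bsub>G\<^esub> C 2 x)}"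
    unfolding removable_def
  proof (intro arg_cong2[where f = "(\<union>)"] Collect_cong iff_exI, goal_cases)
    case (1 D i i' j)
    then show ?case
      using cover[of i i' j] interval[of j i] mem1[of i i' j] by blast
  next
    case (2 D i i' j)
    then show ?case
      using cover2[of j] chain[of i i' j] interval[of j i] mem1[of 1 2 j] by (auto simp: C)
  next
    case (3 D j)
    then show ?case
      using cover2[of j] chain12[of j] interval[of j] mem1[of 1 2 j] by (auto simp: C)
  qed
  finally have main: "{carrier G - M |M. maximal_sublattice M G} = \<dots>" .
  have not_chain: "point_closure G j \<notin> segment_chain X (r i')"
    if ii: "{i, i'} = {1, 2}" and "j \<in> X" "x \<in> X" and cov: "C i j \<prec>\<^bsub>G\<^esub> C i x" "C i' x \<sqsubset>\<^bsub>G\<^esub> C i' j"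
    for i i' j x
  proof -
    have i: "i \<in> {1, 2}" "i' \<in> {1, 2}"
      using ii by auto
    \<comment> \<open>\<open>x\<close> lies in \<open>C i' j\<close> but not in
      \<open>C i j\<close>, which refutes the inclusion that membership in the chain amounts
      to.\<close>
    have "x \<in> C i' j"
      using cov(2) rel_refl[OF i(2) \<open>x \<in> X\<close>] \<open>x \<in> X\<close> by (auto simp: C G in_C_iff)
    moreover have "x \<notin> C i j"
      using cov(1) C_subset_iff[OF i(1) \<open>x \<in> X\<close> \<open>j \<in> X\<close>] by (auto simp: C G covered_by_def in_C_iff)
    ultimately show ?thesis
      using chain[OF ii \<open>j \<in> X\<close>] by auto
  qed
  show ?thesis
    by (intro conjI main) (use not_chain in blast)
qed

end
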